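(* Let $a>0$, let $\varphi,\psi$ be arbitrary real-valued functions of time (defined on $[0,\infty)$), and for real $0\le s\le t$ let $E_2^{[s,t]}$ be the three-dimensional real evolution algebra whose matrix of structural constants is $$\mathcal M_{2}^{[s,t]}=\frac12\begin{pmatrix} 1+\psi(s) & 1+\psi(s) & 1+\psi(s)\\ 1-\varphi(s) & 1-\varphi(s) & 1-\varphi(s)\\ \varphi(s)-\psi(s) & \varphi(s)-\psi(s) & \varphi(s)-\psi(s)\end{pmatrix}\quad\text{if } s\le t<a,$$ and $\mathcal M_2^{[s,t]}=0$ (the zero matrix) if $t\ge a$. For given values $(s,t)$ of time with $0\le s\le t<a$ the algebra $E_2^{[s,t]}$ is isomorphic to: (a) $E_4$ if one of the following holds: 1) $\psi(s)=\varphi(s)=1$; 2) $\psi(s)=\varphi(s)=-1$; 3) $\psi(s)=-1$, $\varphi(s)=1$. (b) $E_5$ if one of the following holds: 1) $\psi(s)=-1$, $|\varphi(s)|<1$; 2) $\varphi(s)=1$, $|\psi(s)|<1$; 3) $\psi(s)=\varphi(s)$, $|\psi(s)|<1$. (c) $E_6$ if one of the following holds: 1) $\psi(s)=-1$, $|\varphi(s)|>1$; 2) $\varphi(s)=1$, $|\psi(s)|>1$; 3) $\psi(s)=\varphi(s)$, $|\psi(s)|>1$. (d) $E_7$ if $(1+\psi(s))(1-\varphi(s))(\varphi(s)-\psi(s))\neq 0$, $(1+\psi(s))(1-\varphi(s))(2+\psi(s)-\varphi(s))>0$ and $(\varphi(s)-\psi(s))(2+\psi(s)-\varphi(s))>0$.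 (e) $E_8$ if one of the following holds: 1) $(1+\psi(s))(1-\varphi(s))(\varphi(s)-\psi(s))\neq 0$, $(1+\psi(s))(1-\varphi(s))(2+\psi(s)-\varphi(s))>0$ and $(\varphi(s)-\psi(s))(2+\psi(s)-\varphi(s))<0$; 2) $(1+\psi(s))(1-\varphi(s))(\varphi(s)-\psi(s))\neq 0$, $(1+\psi(s))(1-\varphi(s))(2+\psi(s)-\varphi(s))<0$ and $(\varphi(s)-\psi(s))(2+\psi(s)-\varphi(s))>0$; 3) $(1+\psi(s))(1-\varphi(s))(\varphi(s)-\psi(s))\neq 0$ and $2+\psi(s)-\varphi(s)=0$. (f) $E_9$ if $(1+\psi(s))(1-\varphi(s))(\varphi(s)-\psi(s))\neq 0$, $(1+\psi(s))(1-\varphi(s))(2+\psi(s)-\varphi(s))<0$ and $(\varphi(s)-\psi(s))(2+\psi(s)-\varphi(s))<0$. For all $(s,t)$ with $0\le s\le t$ and $t\ge a$ the algebra $E_2^{[s,t]}$ is isomorphic to $E_0$.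
   Context: A three-dimensional real evolution algebra with matrix of structural constants $(a_{ij})_{i,j=1}^{3}$ is the real (commutative) algebra with basis $e_1,e_2,e_3$ and multiplication $e_ie_i=\sum_{j=1}^3 a_{ij}e_j$, $e_ie_j=0$ for $i\neq j$. Isomorphism means isomorphism of algebras over $\mathbb{R}$. $E_0$ denotes the trivial three-dimensional evolution algebra (zero multiplication). The algebras $E_4,\dots,E_9$ are the three-dimensional real evolution algebras with the following matrices of structural constants: $$E_4:\begin{pmatrix}1&0&0\\0&0&0\\0&0&0\end{pmatrix},\quad E_5:\begin{pmatrix}1&0&0\\0&0&0\\1&0&0\end{pmatrix},\quad E_6:\begin{pmatrix}1&0&0\\0&0&0\\-1&0&0\end{pmatrix},$$ $$E_7:\begin{pmatrix}1&0&0\\1&0&0\\1&0&0\end{pmatrix},\quad E_8:\begin{pmatrix}1&0&0\\1&0&0\\-1&0&0\end{pmatrix},\quad E_9:\begin{pmatrix}1&0&0\\-1&0&0\\-1&0&0\end{pmatrix}.$$ *)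

theory Defs
  imports "HOL-Analysis.Analysis"
begin

text \<open>
  A not necessarily associative real algebra is represented by its multiplication, a bilinear map
  on a real vector space.  An evolution algebra with natural basis indexed by the type \<open>'n\<close> lives
  on the coordinate space \<open>real^'n\<close>, whose standard basis vectors \<open>axis i 1\<close> play the role
  of the natural basis; row \<open>i\<close> of the matrix of structural constants is the coordinate vector
  of the square of the \<open>i\<close>-th basis vector.  The multiplication is the bilinear extension of
  the multiplication table, as the lemmas below confirm.
\<close>

definition evolution_mult :: "real^'n^'n \<Rightarrow> real^'n \<Rightarrow> real^'n \<Rightarrow> real^'n" where
  "evolution_mult A x y = (\<Sum>i\<in>UNIV. (x $ i * y $ i) *\<^sub>R A $ i)"

lemma bilinear_evolution_mult: "bilinear (evolution_mult A)"
  unfolding bilinear_def evolution_mult_def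
  by (auto intro!: linearI simp: algebra_simps sum.distrib scaleR_sum_right)

lemma evolution_mult_commute: "evolution_mult A x y = evolution_mult A y x"
  by (simp add: evolution_mult_def mult.commute)

lemma evolution_mult_axis:
  "evolution_mult A (axis i 1) (axis j 1) = (if i = j then (\<Sum>k\<in>UNIV. A $ i $ k *\<^sub>R axis k 1) else 0)"
proof -
  have "(\<Sum>k\<in>UNIV. A $ i $ k *\<^sub>R axis k 1) = A $ i"
    using basis_expansion[of "A $ i"] by (simp add: scalar_mult_eq_scaleR)
  moreover have "evolution_mult A (axis i 1) (axis j 1) = (\<Sum>k\<in>UNIV. if k = i then (if i = j then A $ i else 0) else 0)"
    unfolding evolution_mult_def by (intro sum.cong) (auto simp: axis_def)
  ultimately show ?thesis by (simp only: sum.delta finite UNIV_I if_True)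
qed

lemma evolution_mult_unique:
  assumes "bilinear m"
    and "\<And>i j. m (axis i 1) (axis j 1) = (if i = j then (\<Sum>k\<in>UNIV. A $ i $ k *\<^sub>R axis k 1) else 0)"
  shows "m = evolution_mult A"
  by (rule bilinear_eq_stdbasis[OF assms(1) bilinear_evolution_mult])
    (auto simp: Basis_vec_def assms(2) evolution_mult_axis)

definition algebra_isomorphic ::
  "('a::real_vector \<Rightarrow> 'a \<Rightarrow> 'a) \<Rightarrow> ('b::real_vector \<Rightarrow> 'b \<Rightarrow> 'b) \<Rightarrow> bool" where
  "algebra_isomorphic m m' \<longleftrightarrow>
    (\<exists>f. linear f \<and> bij f \<and> (\<forall>x y. f (m x y) = m' (f x) (f y)))"

definition E0 :: "real^3 \<Rightarrow> real^3 \<Rightarrow> real^3" where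
  "E0 = evolution_mult 0"

definition E4 :: "real^3 \<Rightarrow> real^3 \<Rightarrow> real^3" where
  "E4 = evolution_mult (vector [vector [1, 0, 0], vector [0, 0, 0], vector [0, 0, 0]])"

definition E5 :: "real^3 \<Rightarrow> real^3 \<Rightarrow> real^3" where
  "E5 = evolution_mult (vector [vector [1, 0, 0], vector [0, 0, 0], vector [1, 0, 0]])"

definition E6 :: "real^3 \<Rightarrow> real^3 \<Rightarrow> real^3" where
  "E6 = evolution_mult (vector [vector [1, 0, 0], vector [0, 0, 0], vector [-1, 0, 0]])"

definition E7 :: "real^3 \<Rightarrow> real^3 \<Rightarrow> real^3" where
  "E7 = evolution_mult (vector [vector [1, 0, 0], vector [1, 0, 0], vector [1, 0, 0]])"

definition E8 :: "real^3 \<Rightarrow> real^3 \<Rightarrow> real^3" where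
  "E8 = evolution_mult (vector [vector [1, 0, 0], vector [1, 0, 0], vector [-1, 0, 0]])"

definition E9 :: "real^3 \<Rightarrow> real^3 \<Rightarrow> real^3" where
  "E9 = evolution_mult (vector [vector [1, 0, 0], vector [-1, 0, 0], vector [-1, 0, 0]])"

text \<open>Only the values at times \<open>0 \<le> s \<le> t\<close> are meaningful.\<close>

definition M2 :: "real \<Rightarrow> (real \<Rightarrow> real) \<Rightarrow> (real \<Rightarrow> real) \<Rightarrow> real \<Rightarrow> real \<Rightarrow> real^3^3" where
  "M2 a \<phi> \<psi> s t =
    (if t < a then
       (1/2) *\<^sub>R vector
         [vector [1 + \<psi> s,     1 + \<psi> s,     1 + \<psi> s],
          vector [1 - \<phi> s,     1 - \<phi> s,     1 - \<phi> s],
          vector [\<phi> s - \<psi> s, \<phi> s - \<psi> s, \<phi> s - \<psi> s]]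
     else 0)"

definition E2 ::
  "real \<Rightarrow> (real \<Rightarrow> real) \<Rightarrow> (real \<Rightarrow> real) \<Rightarrow> real \<Rightarrow> real \<Rightarrow> real^3 \<Rightarrow> real^3 \<Rightarrow> real^3" where
  "E2 a \<phi> \<psi> s t = evolution_mult (M2 a \<phi> \<psi> s t)"

end

theory Submission
  imports Defs
begin

text \<open>
  All algebras in question have the form \<open>xy = B(x, y) u\<close> with a diagonal bilinear form \<open>B\<close> and a
  fixed vector \<open>u\<close> with \<open>B(u, u) = 1\<close>, except for the zero algebra.  For \<open>E2\<close> with \<open>t < a\<close>, \<open>B\<close> has
  diagonal \<open>p = (1 + \<psi>)/2\<close>, \<open>q = (1 - \<phi>)/2\<close>, \<open>r = (\<phi> - \<psi>)/2\<close> and \<open>u = (1, 1, 1)\<close>, so that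
  \<open>B(u, u) = p + q + r = 1\<close>.  If \<open>p + q \<noteq> 0\<close>, the vectors \<open>u\<close>, \<open>(q, -p, 0)\<close>, \<open>(r, r, -(p + q))\<close> form an
  orthogonal basis whose last two members have squares \<open>pq(p + q)\<close> and \<open>r(p + q)\<close>, and rescaling
  them turns these numbers into their signs.  Permuting the coordinates covers the case \<open>p + q = 0\<close>.
\<close>

section \<open>Algebras whose products all lie on one line, and their isomorphisms\<close>

definition line_mult :: "real^3 \<Rightarrow> real^3 \<Rightarrow> real^3 \<Rightarrow> real^3 \<Rightarrow> real^3" where
  "line_mult c u x y = (\<Sum>i\<in>UNIV. c $ i * (x $ i * y $ i)) *\<^sub>R u"

lemma evolution_mult_line:
  assumes "\<And>i. A $ i = c $ i *\<^sub>R u"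
  shows "evolution_mult A = line_mult c u"
  by (intro ext) (simp add: evolution_mult_def line_mult_def assms scaleR_sum_left mult_ac)

lemma algebra_isomorphic_trans:
  assumes "algebra_isomorphic m m'" "algebra_isomorphic m' m''"
  shows "algebra_isomorphic m m''"
proof -
  obtain f g where "linear f" "bij f" "\<And>x y. f (m x y) = m' (f x) (f y)"
    and "linear g" "bij g" "\<And>x y. g (m' x y) = m'' (g x) (g y)"
    using assms unfolding algebra_isomorphic_def by metis
  then show ?thesis
    unfolding algebra_isomorphic_def
    by (intro exI[of _ "g \<circ> f"]) (simp add: linear_compose bij_comp)
qed

lemma algebra_isomorphic_sym:
  assumes "algebra_isomorphic m m'"
  shows "algebra_isomorphic m' m"
proof -
  obtain f where f: "linear f" "bij f" "\<And>x y. f (m x y) = m' (f x) (f y)"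
    using assms unfolding algebra_isomorphic_def by metis
  have inv: "inv f y = x" if "f x = y" for x y
    using that f(2) by (simp add: bij_is_inj inv_f_eq)
  have f_inv: "f (inv f y) = y" for y
    using f(2) by (simp add: bij_is_surj surj_f_inv_f)
  have "linear (inv f)"
    by (rule linearI; rule inv) (simp_all add: f_inv linear_add[OF f(1)] linear_scale[OF f(1)])
  moreover have "inv f (m' x y) = m (inv f x) (inv f y)" for x y
    by (rule inv) (simp add: f(3) f_inv)
  ultimately show ?thesis
    unfolding algebra_isomorphic_def using f(2) bij_imp_bij_inv by blast
qed

text \<open>In coordinates with respect to the basis \<open>u\<close>, \<open>v\<close>,
  \<open>w\<close>, the vector \<open>u\<close> becomes the first unit vector, and orthogonality
  makes the Gram matrix of \<open>B\<close> diagonal with entries \<open>1\<close>,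
  \<open>B v v\<close>, \<open>B w w\<close>.\<close>

lemma line_mult_orthogonal_basis:
  fixes c u v w :: "real^3"
  defines "B \<equiv> \<lambda>x y. \<Sum>i\<in>UNIV. c $ i * (x $ i * y $ i)"
  assumes "det (vector [u, v, w] :: real^3^3) \<noteq> 0"
    and B: "B u u = 1" "B u v = 0" "B u w = 0" "B v w = 0"
  shows "algebra_isomorphic (line_mult c u) (line_mult (vector [1, B v v, B w w]) (axis 1 1))"
proof -
  \<comment> \<open>The columns of \<open>P\<close> are \<open>u\<close>, \<open>v\<close>,
    \<open>w\<close>, so \<open>P\<close> maps new coordinates to old ones; the isomorphism is
    therefore obtained in the reverse direction first.\<close>
  define P where "P = transpose (vector [u, v, w] :: real^3^3)"
  have P: "P *v y = y $ 1 *\<^sub>R u + y $ 2 *\<^sub>R v + y $ 3 *\<^sub>R w" for y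
    by (simp add: P_def matrix_vector_mult_def transpose_def vec_eq_iff sum_3 mult_ac)
  have "invertible P"
    using assms by (simp add: P_def invertible_det_nz)
  then have bij: "bij ((*v) P)"
    by (simp add: invertible_eq_bij)
  have form: "B (P *v y) (P *v z) = y $ 1 * z $ 1 + B v v * (y $ 2 * z $ 2) + B w w * (y $ 3 * z $ 3)"
    for y z
  proof -
    have "B (P *v y) (P *v z) =
        B u u * (y $ 1 * z $ 1) + B v v * (y $ 2 * z $ 2) + B w w * (y $ 3 * z $ 3)
        + B u v * (y $ 1 * z $ 2 + y $ 2 * z $ 1) + B u w * (y $ 1 * z $ 3 + y $ 3 * z $ 1)
        + B v w * (y $ 2 * z $ 3 + y $ 3 * z $ 2)"
      by (simp add: P B_def sum_3 algebra_simps)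
    then show ?thesis
      by (simp only: B mult_1 mult_zero_left add_0_right)
  qed
  have "P *v line_mult (vector [1, B v v, B w w]) (axis 1 1) y z = line_mult c u (P *v y) (P *v z)"
    for y z
  proof -
    have "line_mult c u (P *v y) (P *v z) = B (P *v y) (P *v z) *\<^sub>R u"
      by (simp add: line_mult_def B_def)
    also have "\<dots> = P *v line_mult (vector [1, B v v, B w w]) (axis 1 1) y z"
      unfolding form by (simp add: P line_mult_def sum_3 axis_def)
    finally show ?thesis ..
  qed
  then have "algebra_isomorphic (line_mult (vector [1, B v v, B w w]) (axis 1 1)) (line_mult c u)"
    unfolding algebra_isomorphic_def using bij matrix_vector_mul_linear by blast
  then show ?thesis
    by (rule algebra_isomorphic_sym)
qed

section \<open>Normal forms over the reals\<close>

lemma square_scale_to_sgn: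
  fixes x :: real
  obtains k where "k \<noteq> 0" "k * k * x = sgn x"
proof (cases "x = 0")
  case True
  then show ?thesis using that[of 1] by simp
next
  case False
  have "(1 / sqrt \<bar>x\<bar>) * (1 / sqrt \<bar>x\<bar>) * x = sgn x"
    using False by (simp add: sgn_if)
  with False show ?thesis by (intro that[of "1 / sqrt \<bar>x\<bar>"]) auto
qed

text \<open>The order in which the two signs appear depends on which coordinate was singled out,
  while \<open>E5\<close>, \<open>E6\<close> and \<open>E8\<close> fix an order. Exchanging the last
  two basis vectors reconciles them.\<close>

lemma line_mult_swap_target:
  assumes "algebra_isomorphic m (line_mult (vector [1, b, c]) (axis 1 1))"
  shows "algebra_isomorphic m (line_mult (vector [1, c, b]) (axis 1 1))"
proof -
  have "algebra_isomorphic (line_mult (vector [1, b, c]) (axis 1 1))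
      (line_mult (vector [1, c, b]) (axis 1 1))"
    using line_mult_orthogonal_basis[of "axis 1 1" "axis 3 1" "axis 2 1" "vector [1, b, c]"]
    by (simp add: det_3 axis_def sum_3)
  with assms show ?thesis
    by (rule algebra_isomorphic_trans)
qed

text \<open>A cyclic shift of coordinates fixes the vector \<open>1\<close>, whose entries are all
  equal. Applied once or twice, it lets any of the three coordinates play the role of the last
  one.\<close>

lemma line_mult_rotate:
  assumes "algebra_isomorphic (line_mult (vector [q, r, p]) 1) m"
  shows "algebra_isomorphic (line_mult (vector [p, q, r]) 1) m"
proof -
  define f :: "real^3 \<Rightarrow> real^3" where "f x = vector [x $ 2, x $ 3, x $ 1]" for x
  have "linear f"
    by (rule linearI) (simp_all add: f_def vec_eq_iff forall_3)
  moreover have "bij f"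
    by (rule bij_betw_byWitness[where f' = "\<lambda>x. vector [x $ 3, x $ 1, x $ 2]"])
      (auto simp: f_def vec_eq_iff forall_3)
  moreover have "f (line_mult (vector [p, q, r]) 1 x y) = line_mult (vector [q, r, p]) 1 (f x) (f y)"
    for x y
    by (simp add: f_def line_mult_def vec_eq_iff forall_3 sum_3)
  ultimately have "algebra_isomorphic (line_mult (vector [p, q, r]) 1) (line_mult (vector [q, r, p]) 1)"
    unfolding algebra_isomorphic_def by blast
  then show ?thesis
    using assms by (rule algebra_isomorphic_trans)
qed

lemma line_mult_normal_form:
  assumes "p + q + r = 1" "p + q \<noteq> 0"
  shows "algebra_isomorphic (line_mult (vector [p, q, r]) 1)
    (line_mult (vector [1, sgn (p * q * (p + q)), sgn (r * (p + q))]) (axis 1 1))"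
proof -
  obtain k where k: "k \<noteq> 0" "k * k * (p * q * (p + q)) = sgn (p * q * (p + q))"
    by (rule square_scale_to_sgn)
  obtain l where l: "l \<noteq> 0" "l * l * (r * (p + q)) = sgn (r * (p + q))"
    by (rule square_scale_to_sgn)
  define v :: "real^3" where "v = vector [k * q, - (k * p), 0]"
  define w :: "real^3" where "w = vector [l * r, l * r, - (l * (p + q))]"
  define c :: "real^3" where "c = vector [p, q, r]"
  let ?B = "\<lambda>x y. \<Sum>i\<in>UNIV. c $ i * (x $ i * y $ i)"
  \<comment> \<open>This factorization shows where \<open>p + q \<noteq> 0\<close> is needed for a
    basis.\<close>
  have "det (vector [1, v, w] :: real^3^3) = k * l * (p + q) * (p + q + r)"
    by (simp add: det_3 v_def w_def algebra_simps)
  then have "det (vector [1, v, w] :: real^3^3) \<noteq> 0"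
    using k(1) l(1) assms by simp
  moreover have "?B 1 1 = 1" "?B 1 v = 0" "?B 1 w = 0" "?B v w = 0"
    using assms(1) by (simp_all add: sum_3 v_def w_def c_def algebra_simps)
  ultimately have "algebra_isomorphic (line_mult c 1)
      (line_mult (vector [1, ?B v v, ?B w w]) (axis 1 1))"
    by (rule line_mult_orthogonal_basis)
  moreover have "?B v v = sgn (p * q * (p + q))"
    unfolding k(2)[symmetric] by (simp add: sum_3 v_def c_def algebra_simps)
  moreover have "?B w w = sgn (r * (p + q))"
  proof -
    have "?B w w = l * l * (r * (p + q)) * (p + q + r)"
      by (simp add: sum_3 w_def c_def algebra_simps)
    then show ?thesis using assms(1) l(2) by simp
  qed
  ultimately show ?thesis by (simp add: c_def)
qed

section \<open>The given algebras in this form, and the exceptional parameter values\<close>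

lemma E2_line:
  assumes "t < a"
  shows "E2 a \<phi> \<psi> s t =
    line_mult (vector [(1 + \<psi> s) / 2, (1 - \<phi> s) / 2, (\<phi> s - \<psi> s) / 2]) 1"
proof -
  have "M2 a \<phi> \<psi> s t $ i =
      vector [(1 + \<psi> s) / 2, (1 - \<phi> s) / 2, (\<phi> s - \<psi> s) / 2] $ i *\<^sub>R 1" for i
    using assms exhaust_3[of i] by (auto simp: M2_def vec_eq_iff forall_3)
  then show ?thesis
    unfolding E2_def by (rule evolution_mult_line)
qed

lemma first_column_line:
  "evolution_mult (vector [vector [1, 0, 0], vector [b, 0, 0], vector [c, 0, 0]]) =
    line_mult (vector [1, b, c]) (axis 1 1)"
proof (rule evolution_mult_line)
  fix i :: 3
  show "(vector [vector [1, 0, 0], vector [b, 0, 0], vector [c, 0, 0]] :: real^3^3) $ i =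
      vector [1, b, c] $ i *\<^sub>R axis 1 1"
    using exhaust_3[of i] by (auto simp: vec_eq_iff forall_3 axis_def)
qed

lemmas normal_form_line =
  E4_def[unfolded first_column_line] E5_def[unfolded first_column_line]
  E6_def[unfolded first_column_line] E7_def[unfolded first_column_line]
  E8_def[unfolded first_column_line] E9_def[unfolded first_column_line]

text \<open>One entry vanishes, so the other two sum to \<open>1\<close> and the symmetric
  expression \<open>p * q + q * r + r * p\<close> reduces to their product. Rotating the zero into
  the last place gives a pair with nonzero sum, and the swap then moves the resulting sign
  \<open>0\<close> to the second place.\<close>

lemma line_mult_degenerate:
  assumes "p + q + r = 1" "p * q * r = 0"
  shows "algebra_isomorphic (line_mult (vector [p, q, r]) 1)
    (line_mult (vector [1, 0, sgn (p * q + q * r + r * p)]) (axis 1 1))"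
proof -
  have last: "algebra_isomorphic (line_mult (vector [x, y, 0]) 1)
      (line_mult (vector [1, 0, sgn (x * y)]) (axis 1 1))" if "x + y = 1" for x y
    using line_mult_swap_target[OF line_mult_normal_form[of x y 0]] that by simp
  consider "r = 0" | "p = 0" | "q = 0" using assms(2) by auto
  then show ?thesis
  proof cases
    case 1
    then show ?thesis using last[of p q] assms(1) by simp
  next
    case 2
    then show ?thesis using line_mult_rotate[OF last[of q r]] assms(1) by simp
  next
    case 3
    then show ?thesis
      using line_mult_rotate[OF line_mult_rotate[OF last[of r p]]] assms(1) by simp
  qed
qed

text \<open>Here \<open>line_mult_normal_form\<close> does not apply directly, so another coordinate
  is singled out. If \<open>q + r \<noteq> 0\<close>, one rotation produces the signs of
  \<open>q * (q + 1)\<close> and of its negative, hence one of each; otherwise the entries are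
  \<open>1, -1, 1\<close> and two rotations lead to \<open>1, 1, -1\<close>.\<close>

lemma line_mult_opposite:
  assumes "p + q = 0" "r = 1" "p \<noteq> 0"
  shows "algebra_isomorphic (line_mult (vector [p, q, r]) 1) E8"
proof (cases "q + r = 0")
  case True
  then have "p = 1" "q = -1" using assms by auto
  then show ?thesis
    using line_mult_rotate[OF line_mult_rotate[OF line_mult_normal_form[of r p q]]] assms
    by (simp add: normal_form_line)
next
  case False
  have iso: "algebra_isomorphic (line_mult (vector [p, q, r]) 1)
      (line_mult (vector [1, sgn (q * (q + 1)), sgn (- (q * (q + 1)))]) (axis 1 1))"
    using line_mult_rotate[OF line_mult_normal_form[of q r p]] False assms
    by (simp add: eq_neg_iff_add_eq_0[symmetric])
  have "q * (q + 1) \<noteq> 0"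
    using False assms by auto
  then consider "q * (q + 1) > 0" | "q * (q + 1) < 0" by linarith
  then show ?thesis
  proof cases
    case 1
    then show ?thesis using iso by (simp add: normal_form_line sgn_minus)
  next
    case 2
    then show ?thesis using line_mult_swap_target[OF iso] by (simp add: normal_form_line sgn_minus)
  qed
qed

section \<open>Case analysis in the parameters\<close>

theorem theorem2:
  fixes a :: real and \<phi> \<psi> :: "real \<Rightarrow> real"
  assumes "a > 0"
  shows "(\<forall>s t. 0 \<le> s \<and> s \<le> t \<and> t < a \<longrightarrow>
      ((\<psi> s = 1 \<and> \<phi> s = 1) \<or> (\<psi> s = -1 \<and> \<phi> s = -1) \<or> (\<psi> s = -1 \<and> \<phi> s = 1)
        \<longrightarrow> algebra_isomorphic (E2 a \<phi> \<psi> s t) E4) \<and>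
      ((\<psi> s = -1 \<and> \<bar>\<phi> s\<bar> < 1) \<or> (\<phi> s = 1 \<and> \<bar>\<psi> s\<bar> < 1) \<or> (\<psi> s = \<phi> s \<and> \<bar>\<psi> s\<bar> < 1)
        \<longrightarrow> algebra_isomorphic (E2 a \<phi> \<psi> s t) E5) \<and>
      ((\<psi> s = -1 \<and> \<bar>\<phi> s\<bar> > 1) \<or> (\<phi> s = 1 \<and> \<bar>\<psi> s\<bar> > 1) \<or> (\<psi> s = \<phi> s \<and> \<bar>\<psi> s\<bar> > 1)
        \<longrightarrow> algebra_isomorphic (E2 a \<phi> \<psi> s t) E6) \<and>
      ((1 + \<psi> s) * (1 - \<phi> s) * (\<phi> s - \<psi> s) \<noteq> 0 \<and>
       (1 + \<psi> s) * (1 - \<phi> s) * (2 + \<psi> s - \<phi> s) > 0 \<and>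
       (\<phi> s - \<psi> s) * (2 + \<psi> s - \<phi> s) > 0
        \<longrightarrow> algebra_isomorphic (E2 a \<phi> \<psi> s t) E7) \<and>
      (((1 + \<psi> s) * (1 - \<phi> s) * (\<phi> s - \<psi> s) \<noteq> 0 \<and>
        (1 + \<psi> s) * (1 - \<phi> s) * (2 + \<psi> s - \<phi> s) > 0 \<and>
        (\<phi> s - \<psi> s) * (2 + \<psi> s - \<phi> s) < 0) \<or>
       ((1 + \<psi> s) * (1 - \<phi> s) * (\<phi> s - \<psi> s) \<noteq> 0 \<and>
        (1 + \<psi> s) * (1 - \<phi> s) * (2 + \<psi> s - \<phi> s) < 0 \<and>
        (\<phi> s - \<psi> s) * (2 + \<psi> s - \<phi> s) > 0) \<or>
       ((1 + \<psi> s) * (1 - \<phi> s) * (\<phi> s - \<psi> s) \<noteq> 0 \<and>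
        2 + \<psi> s - \<phi> s = 0)
        \<longrightarrow> algebra_isomorphic (E2 a \<phi> \<psi> s t) E8) \<and>
      ((1 + \<psi> s) * (1 - \<phi> s) * (\<phi> s - \<psi> s) \<noteq> 0 \<and>
       (1 + \<psi> s) * (1 - \<phi> s) * (2 + \<psi> s - \<phi> s) < 0 \<and>
       (\<phi> s - \<psi> s) * (2 + \<psi> s - \<phi> s) < 0
        \<longrightarrow> algebra_isomorphic (E2 a \<phi> \<psi> s t) E9)) \<and>
    (\<forall>s t. 0 \<le> s \<and> s \<le> t \<and> t \<ge> a \<longrightarrow> algebra_isomorphic (E2 a \<phi> \<psi> s t) E0)"
proof -
  have zero: "algebra_isomorphic (E2 a \<phi> \<psi> s t) E0" if "t \<ge> a" for s t
    using that unfolding E2_def E0_def M2_def algebra_isomorphic_def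
    by (intro exI[of _ id]) (simp add: linear_id)
  \<comment> \<open>Each of the three conditions makes one of the entries \<open>p\<close>,
    \<open>q\<close>, \<open>r\<close> vanish and leaves one free parameter \<open>x\<close>; the
    other two entries are then \<open>(1 - x) / 2\<close> and \<open>(1 + x) / 2\<close>, with
    product \<open>S / 4\<close>.\<close>
  have degenerate:
      "S = 0 \<Longrightarrow> algebra_isomorphic (E2 a \<phi> \<psi> s t) E4"
      "S > 0 \<Longrightarrow> algebra_isomorphic (E2 a \<phi> \<psi> s t) E5"
      "S < 0 \<Longrightarrow> algebra_isomorphic (E2 a \<phi> \<psi> s t) E6"
    if "t < a" and deg: "\<psi> s = -1 \<and> x = \<phi> s \<or> \<phi> s = 1 \<and> x = \<psi> s \<or> \<psi> s = \<phi> s \<and> x = \<psi> s"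
      and S: "S = (1 - x) * (1 + x)" for s t x S
  proof -
    define p q r where pqr: "p = (1 + \<psi> s) / 2" "q = (1 - \<phi> s) / 2" "r = (\<phi> s - \<psi> s) / 2"
    have "p + q + r = 1"
      by (simp add: pqr field_simps)
    moreover have "p * q * r = 0"
      using deg by (auto simp: pqr)
    moreover have sum: "p * q + q * r + r * p = S / 4"
      using deg by (auto simp: pqr S field_simps)
    ultimately have "algebra_isomorphic (E2 a \<phi> \<psi> s t)
        (line_mult (vector [1, 0, sgn (S / 4)]) (axis 1 1))"
      using line_mult_degenerate[of p q r, unfolded sum]
      unfolding E2_line[OF \<open>t < a\<close>] pqr[symmetric] by blast
    then show "S = 0 \<Longrightarrow> algebra_isomorphic (E2 a \<phi> \<psi> s t) E4"
      "S > 0 \<Longrightarrow> algebra_isomorphic (E2 a \<phi> \<psi> s t) E5"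
      "S < 0 \<Longrightarrow> algebra_isomorphic (E2 a \<phi> \<psi> s t) E6"
      by (simp_all add: normal_form_line)
  qed
  have abs_less: "(1 - x) * (1 + x) > 0" if "\<bar>x\<bar> < 1" for x :: real
    using that by (auto simp: zero_less_mult_iff)
  have abs_greater: "(1 - x) * (1 + x) < 0" if "\<bar>x\<bar> > 1" for x :: real
    using that by (auto simp: mult_less_0_iff abs_if split: if_splits)
  define D where "D s = (1 + \<psi> s) * (1 - \<phi> s) * (2 + \<psi> s - \<phi> s)" for s
  define F where "F s = (\<phi> s - \<psi> s) * (2 + \<psi> s - \<phi> s)" for s
  have iso: "algebra_isomorphic (E2 a \<phi> \<psi> s t)
      (line_mult (vector [1, sgn (D s), sgn (F s)]) (axis 1 1))"
    if "t < a" "D s \<noteq> 0" for s t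
  proof -
    define p q r where pqr: "p = (1 + \<psi> s) / 2" "q = (1 - \<phi> s) / 2" "r = (\<phi> s - \<psi> s) / 2"
    have sum: "p + q = (2 + \<psi> s - \<phi> s) / 2" and "p + q + r = 1"
      by (simp_all add: pqr field_simps)
    have D: "p * q * (p + q) = D s / 8" and F: "r * (p + q) = F s / 4"
      unfolding sum by (simp_all add: D_def F_def pqr)
    have "p + q \<noteq> 0"
      using that(2) by (auto simp: sum D_def)
    from line_mult_normal_form[OF \<open>p + q + r = 1\<close> this] show ?thesis
      unfolding E2_line[OF \<open>t < a\<close>] pqr[symmetric] D F by (simp add: sgn_divide)
  qed
  have E7: "algebra_isomorphic (E2 a \<phi> \<psi> s t) E7" if "t < a" "D s > 0" "F s > 0" for s t
    using iso[of t s] that by (simp add: normal_form_line)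
  have E8: "algebra_isomorphic (E2 a \<phi> \<psi> s t) E8" if "t < a" "D s > 0" "F s < 0" for s t
    using iso[of t s] that by (simp add: normal_form_line)
  have E8': "algebra_isomorphic (E2 a \<phi> \<psi> s t) E8" if "t < a" "D s < 0" "F s > 0" for s t
    using line_mult_swap_target[OF iso[of t s]] that by (simp add: normal_form_line)
  \<comment> \<open>Now \<open>p + q = 0\<close>, so \<open>D s = 0\<close> and \<open>iso\<close>
    says nothing; the condition \<open>\<phi> s - \<psi> s = 2\<close> gives
    \<open>r = 1\<close>.\<close>
  have E8'': "algebra_isomorphic (E2 a \<phi> \<psi> s t) E8"
    if "t < a" "2 + \<psi> s - \<phi> s = 0" "(1 + \<psi> s) * (1 - \<phi> s) * (\<phi> s - \<psi> s) \<noteq> 0" for s t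
    unfolding E2_line[OF \<open>t < a\<close>] using that(2,3) by (intro line_mult_opposite) (auto simp flip: add_divide_distrib)
  have E9: "algebra_isomorphic (E2 a \<phi> \<psi> s t) E9" if "t < a" "D s < 0" "F s < 0" for s t
    using iso[of t s] that by (simp add: normal_form_line)
  have E4: "algebra_isomorphic (E2 a \<phi> \<psi> s t) E4" if "t < a"
    and "\<psi> s = 1 \<and> \<phi> s = 1 \<or> \<psi> s = -1 \<and> \<phi> s = -1 \<or> \<psi> s = -1 \<and> \<phi> s = 1" for s t
    \<comment> \<open>In all three cases \<open>\<phi> s\<close> is \<open>1\<close> or
      \<open>-1\<close>, so \<open>x = \<phi> s\<close> makes \<open>S\<close> vanish.\<close>
    using that by (intro degenerate(1)[of t s "\<phi> s"]) auto
  have E5: "algebra_isomorphic (E2 a \<phi> \<psi> s t) E5" if "t < a"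
    and "\<psi> s = -1 \<and> \<bar>\<phi> s\<bar> < 1 \<or> \<phi> s = 1 \<and> \<bar>\<psi> s\<bar> < 1 \<or> \<psi> s = \<phi> s \<and> \<bar>\<psi> s\<bar> < 1" for s t
    using that degenerate(2)[OF _ _ refl abs_less] by blast
  have E6: "algebra_isomorphic (E2 a \<phi> \<psi> s t) E6" if "t < a"
    and "\<psi> s = -1 \<and> \<bar>\<phi> s\<bar> > 1 \<or> \<phi> s = 1 \<and> \<bar>\<psi> s\<bar> > 1 \<or> \<psi> s = \<phi> s \<and> \<bar>\<psi> s\<bar> > 1" for s t
    using that degenerate(3)[OF _ _ refl abs_greater] by blast
  show ?thesis
    \<comment> \<open>Folding the sign conditions into \<open>D\<close> and \<open>F\<close> matches
      the goals with the facts above.\<close>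
    unfolding D_def[symmetric] F_def[symmetric]
    apply (intro conjI allI impI; (elim conjE)?)
    subgoal by (rule E4)
    subgoal by (rule E5)
    subgoal by (rule E6)
    subgoal by (rule E7)
    subgoal using E8 E8' E8'' by (elim disjE conjE)
    subgoal by (rule E9)
    subgoal by (rule zero)
    done
qed

end
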